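(* Let $l\in\mathbb{N}$ with $l\geq 3$ and let $k\in\mathbb{N}$ with $k\geq l$. Define $$\mathcal{U}_{k,l}(m)=\left(2^{l-2}(2^{l-2}+1)m+1\right)\left(2^{2l-4}(2^{l-2}+1)m+1\right)\prod_{i=1}^{k-2}\left(2^{l+i-3}(2^{l-2}+1)^2m+1\right).$$ If $k=l$, then $\mathcal{U}_{k,k}(m)$, as a polynomial in $m$, is a polynomial producing many absolute pseudoprimes with $k$ prime factors. If $k\geq l+1$, then $\mathcal{U}_{k,l}(2^{k-l-1}M)$, as a polynomial in $M$ (written as the product of the $k$ linear factors obtained by substituting $m=2^{k-l-1}M$ in each of the factors above), is a polynomial producing many absolute pseudoprimes with $k$ prime factors.
   Context: $\mathbb{N}$ denotes the set of positive integers. An absolute pseudoprime (Carmichael number) is a composite positive integer $N$ such that $a^{N-1}\equiv 1 \pmod N$ for every integer $a$ prime to $N$. Definition. A polynomial $P(M)=\prod_{i=1}^{k}(\alpha_iM+1)$, a product of $k$ distinct linear polynomials with $\alpha_i\in\mathbb{N}$, is called a polynomial producing many absolute pseudoprimes with $k$ prime factors if $P(M)\equiv 1 \pmod{\alpha_iM}$ for every $M\in\mathbb{N}$ and every $1\leq i\leq k$. (For $k\ge 3$, such a $P$ has the property that $P(M)$ is an absolute pseudoprime with exactly $k$ prime factors whenever all the factors $\alpha_iM+1$ are simultaneously prime.) *)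

theory Defs
  imports
    "HOL-Computational_Algebra.Polynomial"
    "HOL-Number_Theory.Cong"
begin

text \<open>The coefficients \<open>\<alpha> i\<close> are bound existentially: distinct linear polynomials \<open>\<alpha> x + 1\<close> with
  \<open>\<alpha> > 0\<close> are pairwise non-associated primes of the ring of integer polynomials, so \<open>P\<close> determines
  both \<open>k\<close> and the \<open>\<alpha> i\<close> (up to order).\<close>

definition produces_many_absolute_pseudoprimes :: "nat \<Rightarrow> int poly \<Rightarrow> bool" where
  "produces_many_absolute_pseudoprimes k P \<longleftrightarrow>
     (\<exists>\<alpha> :: nat \<Rightarrow> nat.
        (\<forall>i\<in>{1..k}. \<alpha> i > 0) \<and>
        inj_on \<alpha> {1..k} \<and>
        P = (\<Prod>i = 1..k. [:1, int (\<alpha> i):]) \<and>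
        (\<forall>M::nat. M > 0 \<longrightarrow>
           (\<forall>i\<in>{1..k}. [poly P (int M) = 1] (mod (int (\<alpha> i) * int M)))))"

definition U :: "nat \<Rightarrow> nat \<Rightarrow> int poly" where
  "U k l =
     [:1, 2 ^ (l - 2) * (2 ^ (l - 2) + 1):] *
     [:1, 2 ^ (2 * l - 4) * (2 ^ (l - 2) + 1):] *
     (\<Prod>i = 1..k - 2. [:1, 2 ^ (l + i - 3) * (2 ^ (l - 2) + 1)\<^sup>2:])"

end

theory Submission
  imports Defs
begin

text \<open>With \<open>a = l - 2\<close>, \<open>c = 2 ^ a + 1\<close> and \<open>X = 2 ^ a * c\<^sup>2 * m\<close>, the first two factors multiply to
  \<open>1 + X * (1 + 2 ^ (2 * a) * m)\<close> and the others are \<open>1 + 2 ^ i * X\<close> for \<open>i < k - 2\<close>. All coefficients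
  divide \<open>2 ^ e * X\<close> for a suitable \<open>e \<le> k - 2\<close> such that \<open>2 ^ e\<close> divides \<open>2 ^ a * m\<close>, hence \<open>X\<close>.
  Modulo \<open>2 ^ e * X\<close> the square of \<open>X\<close> vanishes, so only the linear terms survive, and these add up
  to \<open>X * (1 + (2 ^ (k - 2) - 1)) = 2 ^ (k - 2) * X\<close>, which vanishes too.\<close>

text \<open>Multiplying in one more factor creates a single new quadratic term, a multiple of
  \<open>X * X\<close>, which \<open>D\<close> divides.\<close>

lemma cong_prod_one_plus_mult:
  fixes X D :: int and n :: nat
  assumes "D dvd X * X"
  shows "[(\<Prod>i<n. 1 + f i * X) = 1 + X * (\<Sum>i<n. f i)] (mod D)"
proof (induction n)
  case (Suc n)
  have "[(\<Prod>i<Suc n. 1 + f i * X) = (1 + X * (\<Sum>i<n. f i)) * (1 + f n * X)] (mod D)"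
    using cong_mult[OF Suc cong_refl] by simp
  also have "(1 + X * (\<Sum>i<n. f i)) * (1 + f n * X)
      = 1 + X * (\<Sum>i<Suc n. f i) + X * X * ((\<Sum>i<n. f i) * f n)"
    by (simp add: algebra_simps)
  also have "[\<dots> = 1 + X * (\<Sum>i<Suc n. f i)] (mod D)"
    using assms by (simp add: cong_iff_dvd_diff)
  finally show ?case .
qed simp

lemma cong_product_one:
  fixes m :: int
  assumes "(2::int) ^ e dvd 2 ^ a * m" and "e \<le> n"
  defines "c \<equiv> (2::int) ^ a + 1"
  shows "[(1 + 2 ^ a * c * m) * (1 + 2 ^ (2 * a) * c * m) * (\<Prod>i<n. 1 + 2 ^ (a + i) * c\<^sup>2 * m) = 1]
    (mod 2 ^ (a + e) * c\<^sup>2 * m)"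
proof -
  define X where "X = 2 ^ a * c\<^sup>2 * m"
  define D where "D = 2 ^ e * X"
  have "(2::int) ^ e dvd X"
    using dvd_mult2[OF assms(1), of "c\<^sup>2"] by (simp add: X_def mult_ac)
  then have XX: "D dvd X * X"
    unfolding D_def by (rule mult_dvd_mono) simp
  have "(2::int) ^ e dvd 2 ^ a * (2 ^ a * m)"
    using assms(1) by (rule dvd_mult)
  then have "(2::int) ^ e dvd 2 ^ (2 * a) * m"
    by (simp only: mult_2 power_add mult.assoc)
  then have mX: "D dvd 2 ^ (2 * a) * m * X"
    unfolding D_def by (rule mult_dvd_mono) simp
  have nX: "D dvd 2 ^ n * X"
    unfolding D_def using assms(2) by (intro mult_dvd_mono le_imp_power_dvd) simp_all
  \<comment> \<open>The coefficients \<open>2 ^ a * c\<close> and \<open>2 ^ (2 * a) * c\<close> add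
    up to \<open>2 ^ a * c * (1 + 2 ^ a) = 2 ^ a * c\<^sup>2\<close>, so the linear part is exactly
    \<open>X\<close>; the quadratic part vanishes modulo \<open>D\<close> by
    \<open>mX\<close>.\<close>
  have first: "(1 + 2 ^ a * c * m) * (1 + 2 ^ (2 * a) * c * m) = 1 + X + 2 ^ (2 * a) * m * X"
    unfolding X_def c_def mult_2 power_add by algebra
  have "(\<Prod>i<n. 1 + 2 ^ (a + i) * c\<^sup>2 * m) = (\<Prod>i<n. 1 + 2 ^ i * X)"
    by (simp add: X_def power_add mult_ac)
  also have "[\<dots> = 1 + X * (\<Sum>i<n. 2 ^ i)] (mod D)"
    by (rule cong_prod_one_plus_mult[OF XX])
  also have "(\<Sum>i<n. 2 ^ i) = (2::int) ^ n - 1"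
    using power_diff_1_eq[of "2::int" n] by simp
  finally have "[(1 + X + 2 ^ (2 * a) * m * X) * (\<Prod>i<n. 1 + 2 ^ (a + i) * c\<^sup>2 * m)
      = (1 + X) * (1 + X * (2 ^ n - 1))] (mod D)"
    using mX by (intro cong_mult) (simp_all add: cong_iff_dvd_diff)
  also have "(1 + X) * (1 + X * (2 ^ n - 1)) = 1 + (2 ^ n * X + X * X * (2 ^ n - 1))"
    by (simp add: algebra_simps)
  also have "[\<dots> = 1] (mod D)"
    using dvd_add[OF nX dvd_mult2[OF XX]] by (simp add: cong_iff_dvd_diff)
  finally have "[(1 + X + 2 ^ (2 * a) * m * X) * (\<Prod>i<n. 1 + 2 ^ (a + i) * c\<^sup>2 * m) = 1] (mod D)" .
  moreover have "2 ^ (a + e) * c\<^sup>2 * m = D"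
    by (simp add: D_def X_def power_add mult_ac)
  ultimately show ?thesis
    by (simp only: first)
qed

lemma two_power_mult_odd_eq_iff:
  fixes x y :: nat
  assumes "odd x" "odd y"
  shows "2 ^ i * x = 2 ^ j * y \<longleftrightarrow> i = j \<and> x = y"
proof -
  have key: "i = j \<and> x = y" if eq: "2 ^ i * x = 2 ^ j * y" and le: "i \<le> j" and "odd x" for i j x y :: nat
  proof -
    obtain d where d: "j = i + d"
      using le le_Suc_ex by blast
    then have "x = 2 ^ d * y"
      using eq by (simp add: power_add)
    \<comment> \<open>A positive \<open>d\<close> would make \<open>x\<close> even.\<close>
    with d \<open>odd x\<close> show ?thesis
      by (cases d) auto
  qed
  show ?thesis
    using key[of i x j y] key[of j y i x] assms by (cases "i \<le> j") auto
qed

text \<open>Here \<open>a\<close> stands for \<open>l - 2\<close>. The number of factors does not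
  enter, so one sequence serves every \<open>k\<close>. Index 0 repeats the value at 3 because of
  truncated subtraction, so only indices from 1 on are meaningful.\<close>

definition U_coeff :: "nat \<Rightarrow> nat \<Rightarrow> nat" where
  "U_coeff a j =
     (if j = 1 then 2 ^ a * (2 ^ a + 1)
      else if j = 2 then 2 ^ (2 * a) * (2 ^ a + 1)
      else 2 ^ (a + (j - 3)) * (2 ^ a + 1)\<^sup>2)"

lemma U_coeff_pos: "U_coeff a j > 0"
  by (simp add: U_coeff_def)

text \<open>The odd part, \<open>c\<close> or \<open>c\<^sup>2\<close>, separates the first two
  coefficients from the rest; within each group the exponent of 2 determines the index. Positivity
  of \<open>a\<close> makes \<open>c\<close> odd and greater than 1, and \<open>a\<close> different
  from \<open>2 * a\<close>.\<close>

lemma inj_on_U_coeff: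
  assumes "a > 0"
  shows "inj_on (U_coeff a) {1..}"
proof -
  define c :: nat where "c = 2 ^ a + 1"
  define p where "p j = (if j = 1 then a else if j = 2 then 2 * a else a + (j - 3))" for j :: nat
  define q where "q j = (if j \<le> 2 then c else c\<^sup>2)" for j :: nat
  have U: "U_coeff a j = 2 ^ p j * q j" if "j \<ge> 1" for j
    using that unfolding U_coeff_def p_def q_def c_def by auto
  have "odd c" "c > 1"
    using assms by (simp_all add: c_def)
  then have odd_q: "odd (q j)" and q_inj: "q i = q j \<Longrightarrow> i \<le> 2 \<longleftrightarrow> j \<le> 2" for i j
    by (auto simp: q_def power2_eq_square split: if_splits)
  show ?thesis
  proof (rule inj_onI)
    fix i j
    assume ij: "i \<in> {1..}" "j \<in> {1..}" and "U_coeff a i = U_coeff a j"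
    then have "p i = p j \<and> q i = q j"
      using two_power_mult_odd_eq_iff[OF odd_q odd_q] by (simp add: U)
    then have "p i = p j" "i \<le> 2 \<longleftrightarrow> j \<le> 2"
      using q_inj[of i j] by simp_all
    then show "i = j"
      using ij assms unfolding p_def by (auto split: if_splits)
  qed
qed

text \<open>The function \<open>g\<close> is arbitrary so that the same splitting applies to linear
  polynomials and to their values.\<close>

lemma prod_U_coeff:
  fixes g :: "nat \<Rightarrow> 'a::comm_monoid_mult"
  shows "(\<Prod>j = 1..n + 2. g (U_coeff a j)) =
    g (2 ^ a * (2 ^ a + 1)) * g (2 ^ (2 * a) * (2 ^ a + 1)) *
    (\<Prod>i<n. g (2 ^ (a + i) * (2 ^ a + 1)\<^sup>2))"
  by (induction n) (simp_all add: U_coeff_def numeral_2_eq_2 numeral_3_eq_3 mult.assoc)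

lemma U_eq_prod_U_coeff: "U (n + 2) (a + 2) = (\<Prod>j = 1..n + 2. [:1, int (U_coeff a j):])"
proof -
  have "(\<Prod>i = 1..n. [:1, 2 ^ (a + 2 + i - 3) * (2 ^ a + 1)\<^sup>2 :: int:])
      = (\<Prod>i<n. [:1, 2 ^ (a + i) * (2 ^ a + 1)\<^sup>2:])"
    by (rule prod.reindex_bij_witness[of _ Suc "\<lambda>i. i - 1"]) auto
  moreover have "2 * (a + 2) - 4 = 2 * a"
    by simp
  ultimately show ?thesis
    by (simp only: prod_U_coeff[where g = "\<lambda>x. [:1, int x:]"] U_def add_diff_cancel_right'
        of_nat_mult of_nat_power of_nat_add of_nat_1 of_nat_numeral)
qed

text \<open>The largest exponents of 2 are \<open>2 * a\<close> at index 2 and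
  \<open>a + n - 1\<close> at index \<open>n + 2\<close>; the two bounds on \<open>e\<close> keep
  both at most \<open>a + e\<close>.\<close>

lemma U_coeff_dvd:
  assumes "j \<in> {1..n + 2}" and "a \<le> e" and "n \<le> e + 1"
  shows "U_coeff a j dvd 2 ^ (a + e) * (2 ^ a + 1)\<^sup>2"
proof -
  define c :: nat where "c = 2 ^ a + 1"
  show ?thesis
    using assms unfolding U_coeff_def c_def[symmetric]
    by (auto intro!: mult_dvd_mono le_imp_power_dvd)
qed

text \<open>Both cases of the theorem at once: \<open>t = 0\<close> with \<open>n = a\<close> is
  \<open>k = l\<close>, and \<open>n = a + t + 1\<close> is \<open>t = k - l - 1\<close>.\<close>

lemma produces_many_absolute_pseudoprimes_U:
  assumes "a > 0" and "n = a + t \<or> n = a + t + 1"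
  shows "produces_many_absolute_pseudoprimes (n + 2) (pcompose (U (n + 2) (a + 2)) [:0, 2 ^ t:])"
  unfolding produces_many_absolute_pseudoprimes_def
proof (intro exI[of _ "\<lambda>j. U_coeff a j * 2 ^ t"] conjI ballI allI impI)
  show "U_coeff a j * 2 ^ t > 0" for j
    by (simp add: U_coeff_pos)
  show "inj_on (\<lambda>j. U_coeff a j * 2 ^ t) {1..n + 2}"
    using inj_on_subset[OF inj_on_U_coeff[OF assms(1)], of "{1..n + 2}"] by (auto simp: inj_on_def)
  show P: "pcompose (U (n + 2) (a + 2)) [:0, 2 ^ t:] =
      (\<Prod>j = 1..n + 2. [:1, int (U_coeff a j * 2 ^ t):])"
    unfolding U_eq_prod_U_coeff pcompose_prod by (simp add: pcompose_pCons mult.commute)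
  fix M j :: nat
  assume j: "j \<in> {1..n + 2}"
  \<comment> \<open>This is the power of 2 visible in \<open>2 ^ a * m\<close>. As \<open>n\<close>
    is \<open>e\<close> or \<open>e + 1\<close>, both \<open>e \<le> n\<close> (for the congruence)
    and \<open>n \<le> e + 1\<close> (for the divisibility) hold.\<close>
  define e where "e = a + t"
  define m where "m = (2::int) ^ t * int M"
  have "poly (pcompose (U (n + 2) (a + 2)) [:0, 2 ^ t:]) (int M) =
      (\<Prod>j = 1..n + 2. 1 + int (U_coeff a j) * m)"
    unfolding P poly_prod by (simp add: m_def mult_ac)
  also have "\<dots> = (1 + 2 ^ a * (2 ^ a + 1) * m) * (1 + 2 ^ (2 * a) * (2 ^ a + 1) * m) *
      (\<Prod>i<n. 1 + 2 ^ (a + i) * (2 ^ a + 1)\<^sup>2 * m)"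
    by (simp only: prod_U_coeff[where g = "\<lambda>x. 1 + int x * m"]
        of_nat_mult of_nat_power of_nat_add of_nat_1 of_nat_numeral)
  also have "[\<dots> = 1] (mod 2 ^ (a + e) * (2 ^ a + 1)\<^sup>2 * m)"
    using assms(2) by (intro cong_product_one) (auto simp: e_def m_def power_add mult.assoc)
  finally have *: "[poly (pcompose (U (n + 2) (a + 2)) [:0, 2 ^ t:]) (int M) = 1]
    (mod 2 ^ (a + e) * (2 ^ a + 1)\<^sup>2 * m)" .
  have "U_coeff a j dvd 2 ^ (a + e) * (2 ^ a + 1)\<^sup>2"
    using j assms(2) by (intro U_coeff_dvd[of j n]) (auto simp: e_def)
  then have "int (U_coeff a j) dvd int (2 ^ (a + e) * (2 ^ a + 1)\<^sup>2)"
    by (simp only: int_dvd_int_iff)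
  then have "int (U_coeff a j) * m dvd 2 ^ (a + e) * (2 ^ a + 1)\<^sup>2 * m"
    by (intro mult_dvd_mono) (simp_all add: add.commute)
  then have "int (U_coeff a j * 2 ^ t) * int M dvd 2 ^ (a + e) * (2 ^ a + 1)\<^sup>2 * m"
    by (simp add: m_def mult.assoc)
  with * show "[poly (pcompose (U (n + 2) (a + 2)) [:0, 2 ^ t:]) (int M) = 1]
      (mod int (U_coeff a j * 2 ^ t) * int M)"
    by (rule cong_dvd_modulus)
qed

theorem mainTheorem2:
  fixes k l :: nat
  assumes "l \<ge> 3" and "k \<ge> l"
  shows "(k = l \<longrightarrow> produces_many_absolute_pseudoprimes k (U k k)) \<and>
         (k \<ge> l + 1 \<longrightarrow>
            produces_many_absolute_pseudoprimes k (pcompose (U k l) [:0, 2 ^ (k - l - 1):]))"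
proof -
  obtain a where l: "l = a + 2" and a: "a > 0"
    using assms(1) by (intro that[of "l - 2"]) auto
  obtain n where k: "k = n + 2" and n: "n \<ge> a"
    using assms l by (intro that[of "k - 2"]) auto
  show ?thesis
  proof (intro conjI impI)
    assume "k = l"
    then show "produces_many_absolute_pseudoprimes k (U k k)"
      using produces_many_absolute_pseudoprimes_U[OF a, of n 0] k l by (simp add: pcompose_idR)
  next
    assume "k \<ge> l + 1"
    then show "produces_many_absolute_pseudoprimes k (pcompose (U k l) [:0, 2 ^ (k - l - 1):])"
      using produces_many_absolute_pseudoprimes_U[OF a, of n "k - l - 1"] k l by simp
  qed
qed

end
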